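(* Let $n, d \ge 1$ be integers, let $\mathbf{x} = (x_1,\ldots,x_n)$, and let $P \in \mathbb{C}[\mathbf{x}]$ be any homogeneous polynomial of degree $d$. Then there exists a depth-$3$ ($\sum\prod\sum$) circuit $C$ over $\mathbb{C}(\varepsilon)$ in the variables $\mathbf{x}$, with top fan-in at most $d+1$ and formal degree at most $d\cdot 2^d\cdot \binom{n+d-1}{d-1}$, such that the polynomial computed by $C$ satisfies $$C \equiv P + \varepsilon\, Q,$$ where $Q \in \mathbb{C}[\varepsilon,\mathbf{x}]$ and every monomial (in $\mathbf{x}$) with a non-zero coefficient in $Q$ has degree (in $\mathbf{x}$) strictly greater than $d$.
   Context: $\varepsilon$ is a formal variable independent of $\mathbf{x}$, and $\mathbb{C}(\varepsilon)$ is the field of rational functions in $\varepsilon$. A depth-$3$ ($\sum\prod\sum$) circuit over a field $\mathbb{F}$ in variables $\mathbf{x}$ is an expression $\sum_{i=1}^{k}\prod_{j=1}^{D_i} L_{i,j}$, where each $L_{i,j}$ is an affine form in $\mathbf{x}$, i.e. a polynomial of degree at most $1$ in $\mathbf{x}$ with coefficients in $\mathbb{F}$ (scalar multiples of products can be absorbed into affine forms). Its top fan-in is $k$ and its formal degree is $\max_i D_i$. The symbol $\equiv$ denotes equality of polynomials in $\mathbf{x}$ over $\mathbb{C}(\varepsilon)$. *)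

theory Defs
  imports
    "HOL-Library.Poly_Mapping"
    "HOL-Computational_Algebra.Computational_Algebra"
begin

text \<open>
  Monomials are exponent vectors of finite support, and a polynomial is the finitely supported
  map from monomials to coefficients, with the convolution product of \<^theory>\<open>HOL-Library.Poly_Mapping\<close>.
  The polynomial ring in \<open>x\<^sub>1, \<dots>, x\<^sub>n\<close> is the subring of polynomials mentioning only the
  variables with index in \<open>{1..n}\<close>.
\<close>

type_synonym monomial = "nat \<Rightarrow>\<^sub>0 nat"
type_synonym 'a mpoly = "monomial \<Rightarrow>\<^sub>0 'a"

definition mdeg :: "monomial \<Rightarrow> nat" where
  "mdeg m = (\<Sum>i\<in>Poly_Mapping.keys m. Poly_Mapping.lookup m i)"

definition in_vars :: "nat \<Rightarrow> 'a::zero mpoly \<Rightarrow> bool" where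
  "in_vars n p \<longleftrightarrow> (\<forall>m\<in>Poly_Mapping.keys p. Poly_Mapping.keys m \<subseteq> {1..n})"

text \<open>The zero polynomial is homogeneous of every degree.\<close>

definition homogeneous :: "nat \<Rightarrow> 'a::zero mpoly \<Rightarrow> bool" where
  "homogeneous d p \<longleftrightarrow> (\<forall>m\<in>Poly_Mapping.keys p. mdeg m = d)"

definition affine_form :: "nat \<Rightarrow> 'a::zero mpoly \<Rightarrow> bool" where
  "affine_form n p \<longleftrightarrow> in_vars n p \<and> (\<forall>m\<in>Poly_Mapping.keys p. mdeg m \<le> 1)"

text \<open>
  A depth-3 circuit is given by its list of product gates, each of which is the list of
  its input affine forms.
\<close>

type_synonym 'a circuit = "'a mpoly list list"

definition depth3_circuit :: "nat \<Rightarrow> 'a::zero circuit \<Rightarrow> bool" where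
  "depth3_circuit n C \<longleftrightarrow> (\<forall>Ls\<in>set C. \<forall>L\<in>set Ls. affine_form n L)"

definition top_fanin :: "'a circuit \<Rightarrow> nat" where
  "top_fanin C = length C"

text \<open>The extra \<open>0\<close> only serves to give the empty sum formal degree \<open>0\<close>.\<close>

definition formal_degree :: "'a circuit \<Rightarrow> nat" where
  "formal_degree C = Max (insert 0 (length ` set C))"

definition computed_poly :: "'a::comm_semiring_1 circuit \<Rightarrow> 'a mpoly" where
  "computed_poly C = (\<Sum>Ls\<leftarrow>C. \<Prod>L\<leftarrow>Ls. L)"

text \<open>
  \<open>\<complex>(\<epsilon>)\<close> is the fraction field of \<open>\<complex>[\<epsilon>]\<close>, and \<open>\<complex>[\<epsilon>,x]\<close> is taken as \<open>\<complex>[\<epsilon>][x]\<close>.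
\<close>

type_synonym ratfun = "complex poly fract"

definition emb_poly :: "complex poly \<Rightarrow> ratfun" where
  "emb_poly c = Fraction_Field.Fract c 1"

definition emb_const :: "complex \<Rightarrow> ratfun" where
  "emb_const c = emb_poly [:c:]"

definition eps :: ratfun where
  "eps = emb_poly [:0, 1:]"

definition const_mpoly :: "'a::zero \<Rightarrow> 'a mpoly" where
  "const_mpoly c = Poly_Mapping.single 0 c"

end

theory Submission
  imports Defs
begin

text \<open>
  Write \<open>P = L\<^sub>1\<^sup>d + \<dots> + L\<^sub>m\<^sup>d\<close> with linear forms \<open>L\<^sub>i\<close>. Since \<open>1 + T\<^sup>d\<close> splits into factors \<open>1 + c\<^sub>j T\<close> over
  the complex numbers, \<open>\<Prod>\<^sub>i (1 + \<epsilon>\<^sup>d L\<^sub>i\<^sup>d)\<close> is a product of \<open>d m\<close> affine forms, and it equals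
  \<open>1 + \<epsilon>\<^sup>d P\<close> plus terms divisible by the square of \<open>\<epsilon>\<^sup>d\<close> and of degree at least \<open>2 d\<close>. Subtracting \<open>1\<close>
  and dividing by \<open>\<epsilon>\<^sup>d\<close> gives a circuit with only two product gates.

  To bound \<open>m\<close>, write \<open>P\<close> as a sum, over the monomials of degree \<open>d - 1\<close>, of products of
  \<open>d\<close> linear forms; by polarization, each of them is a sum of at most \<open>2\<^sup>d - 1\<close> powers. The \<open>- 1\<close>, from
  the empty subset sum, leaves room in the formal degree for the gate input \<open>\<epsilon>\<^bsup>-d\<^esup>\<close>.
\<close>

section \<open>Ring homomorphisms\<close>

text \<open>One notion serves all the maps between coefficient rings in use: constants into
  polynomials, complex numbers into polynomials in \<open>eps\<close>, those into rational
  functions, and the coefficientwise lifts.\<close>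

locale comm_ring_map =
  fixes h :: "'a::comm_ring_1 \<Rightarrow> 'b::comm_ring_1"
  assumes add: "h (x + y) = h x + h y"
    and mult: "h (x * y) = h x * h y"
    and one: "h 1 = 1"
begin

lemma zero: "h 0 = 0"
  using add[of 0 0] by simp

lemma uminus: "h (- x) = - h x"
  using add[of x "- x"] zero by (simp add: eq_neg_iff_add_eq_0 add.commute)

lemma power: "h (x ^ k) = h x ^ k"
  by (induction k) (simp_all add: one mult)

lemma prod_list: "h (prod_list xs) = prod_list (map h xs)"
  by (induction xs) (simp_all add: one mult)

lemma sum_list: "h (sum_list xs) = sum_list (map h xs)"
  by (induction xs) (simp_all add: zero add)

lemma lookup_map: "Poly_Mapping.lookup (Poly_Mapping.map h p) k = h (Poly_Mapping.lookup p k)"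
  by (simp add: Poly_Mapping.map.rep_eq when_def zero)

lemma keys_map_subset: "Poly_Mapping.keys (Poly_Mapping.map h p) \<subseteq> Poly_Mapping.keys p"
  by (auto simp: in_keys_iff lookup_map zero)

lemma map_single: "Poly_Mapping.map h (Poly_Mapping.single k c) = Poly_Mapping.single k (h c)"
  by (rule poly_mapping_eqI) (simp add: lookup_map lookup_single when_def zero)

lemma map_add: "Poly_Mapping.map h (p + q) = Poly_Mapping.map h p + Poly_Mapping.map h q"
  by (rule poly_mapping_eqI) (simp add: lookup_map lookup_add add)

lemma map_zero: "Poly_Mapping.map h 0 = 0"
  by (rule poly_mapping_eqI) (simp add: lookup_map zero)

lemma map_poly_mapping:
  "comm_ring_map (Poly_Mapping.map h :: ('c::comm_monoid_add \<Rightarrow>\<^sub>0 'a) \<Rightarrow> ('c \<Rightarrow>\<^sub>0 'b))"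
proof
  let ?H = "Poly_Mapping.map h :: ('c \<Rightarrow>\<^sub>0 'a) \<Rightarrow> ('c \<Rightarrow>\<^sub>0 'b)"
  show "?H (p + q) = ?H p + ?H q" for p q
    by (rule map_add)
  show "?H 1 = 1"
    by (simp add: map_single one flip: single_one)
  \<comment> \<open>Updating at a fresh key adds a monomial, so \<open>update_induct\<close> becomes
    induction over sums of monomials. Both sides are additive in each factor, which reduces
    multiplicativity to products of two monomials.\<close>
  have update: "Poly_Mapping.update a b f = Poly_Mapping.single a b + f"
    if "a \<notin> Poly_Mapping.keys f" for a :: 'c and b :: 'a and f
    using that
    by (intro poly_mapping_eqI) (auto simp: lookup_update lookup_add lookup_single when_def in_keys_iff)
  have single: "?H (Poly_Mapping.single a b * q) = ?H (Poly_Mapping.single a b) * ?H q" for a b q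
    by (induction q rule: update_induct)
      (simp_all add: map_zero update distrib_left map_add map_single mult_single mult)
  show "?H (p * q) = ?H p * ?H q" for p q
    by (induction p rule: update_induct) (simp_all add: map_zero update distrib_right map_add single)
qed

text \<open>This carries a factorization of a univariate polynomial to an identity at any point
  \<open>T\<close> of the target ring of \<open>h\<close>.\<close>

lemma poly_map_mult: "poly (map_poly h (p * q)) T = poly (map_poly h p) T * poly (map_poly h q) T"
proof -
  have pCons: "poly (map_poly h (pCons a p)) T = h a + T * poly (map_poly h p) T" for a p
    by (cases "pCons a p = 0") (simp_all add: map_poly_pCons zero)
  have add: "poly (map_poly h (p + q)) T = poly (map_poly h p) T + poly (map_poly h q) T" for p q
    by (induction p q rule: poly_induct2) (simp_all add: pCons add algebra_simps)
  have smult: "poly (map_poly h (smult c p)) T = h c * poly (map_poly h p) T" for c p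
    by (induction p) (simp_all add: pCons mult algebra_simps)
  show ?thesis
    by (induction p) (simp_all add: pCons add smult zero algebra_simps)
qed

end

lemma comm_ring_map_const_mpoly: "comm_ring_map (const_mpoly :: 'a::comm_ring_1 \<Rightarrow> 'a mpoly)"
  by standard (simp_all add: const_mpoly_def single_add mult_single)

lemma comm_ring_map_const_poly: "comm_ring_map (\<lambda>c::'a::comm_ring_1. [:c:])"
  by standard (simp_all add: one_pCons)

lemma comm_ring_map_emb_poly: "comm_ring_map emb_poly"
  by standard (simp_all add: emb_poly_def One_fract_def)

text \<open>The roots of \<open>1 + T^d\<close> give monic factors \<open>T - x\<close>; reversing
  coefficients turns them into factors \<open>1 - x T\<close>. The list \<open>cs\<close> is fixed
  before \<open>h\<close> and \<open>T\<close>, since the factorization is an identity of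
  polynomials.\<close>

lemma one_plus_power_factorization:
  assumes "d \<ge> 1"
  obtains cs :: "'a::alg_closed_field list" where "length cs = d"
    and "\<And>(h :: 'a \<Rightarrow> 'b::comm_ring_1) T. comm_ring_map h \<Longrightarrow> 1 + T ^ d = (\<Prod>c\<leftarrow>cs. 1 + h c * T)"
proof -
  define p :: "'a poly" where "p = monom 1 d + 1"
  have deg: "degree p = d" and lc: "lead_coeff p = 1"
    using assms by (simp_all add: p_def degree_add_eq_left degree_monom_eq)
  then have "p \<noteq> 0"
    using assms by auto
  from alg_closed_imp_factorization[OF this] obtain A
    where A: "size A = d" "p = (\<Prod>x\<in>#A. [:- x, 1:])"
    using deg lc by auto
  obtain xs where xs: "mset xs = A"
    using ex_mset by blast
  \<comment> \<open>The coefficients of \<open>1 + T^d\<close> read the same in both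
    directions.\<close>
  have "reflect_poly p = p"
    using assms by (intro poly_eqI) (unfold coeff_reflect_poly deg, auto simp: p_def coeff_1)
  moreover have "reflect_poly p = (\<Prod>x\<leftarrow>xs. [:1, - x:])"
  proof -
    have "reflect_poly [:- x, 1:] = [:1, - x:]" for x :: 'a
      by (cases "x = 0") (simp_all add: reflect_poly_pCons reflect_poly_pCons' one_pCons)
    moreover have "p = (\<Prod>x\<leftarrow>xs. [:- x, 1:])"
      by (simp add: A(2) flip: xs prod_mset_prod_list)
    ultimately show ?thesis
      by (simp add: reflect_poly_prod_list o_def)
  qed
  ultimately have p: "p = (\<Prod>x\<leftarrow>xs. [:1, - x:])" by simp
  show thesis
  proof (rule that[of "map uminus xs"])
    show "length (map uminus xs) = d"
      using A(1) by (simp flip: xs)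
    fix h :: "'a \<Rightarrow> 'b" and T
    assume "comm_ring_map h"
    then interpret comm_ring_map h .
    have "poly (map_poly h (\<Prod>x\<leftarrow>ys. [:1, - x:])) T = (\<Prod>c\<leftarrow>map uminus ys. 1 + h c * T)" for ys
      by (induction ys)
        (simp_all add: poly_map_mult one map_poly_pCons zero mult.commute del: mult_pCons_left)
    from this[of xs] have "poly (map_poly h p) T = (\<Prod>c\<leftarrow>map uminus xs. 1 + h c * T)"
      by (simp only: p[symmetric])
    moreover have "map_poly h p = monom 1 d + 1"
      by (rule poly_eqI) (auto simp: coeff_map_poly zero one p_def add)
    ultimately show "1 + T ^ d = (\<Prod>c\<leftarrow>map uminus xs. 1 + h c * T)"
      by (simp add: poly_monom add.commute)
  qed
qed

section \<open>Supports of polynomials\<close>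

text \<open>A set \<open>K\<close> of degrees lets one inclusion of supports express linear
  (\<open>{1}\<close>), affine (\<open>{..1}\<close>), homogeneous (\<open>{d}\<close>) and
  high-degree (\<open>{d<..}\<close>) polynomials in the right variables.\<close>

definition mons :: "nat \<Rightarrow> nat set \<Rightarrow> monomial set" where
  "mons n K = {m. Poly_Mapping.keys m \<subseteq> {1..n} \<and> mdeg m \<in> K}"

lemma keys_subset_mons_iff:
  "Poly_Mapping.keys p \<subseteq> mons n K \<longleftrightarrow> in_vars n p \<and> (\<forall>m\<in>Poly_Mapping.keys p. mdeg m \<in> K)"
  by (auto simp: mons_def in_vars_def)

lemma mdeg_eq_sum:
  assumes "finite A" "Poly_Mapping.keys m \<subseteq> A"
  shows "mdeg m = (\<Sum>i\<in>A. Poly_Mapping.lookup m i)"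
  unfolding mdeg_def using assms by (intro sum.mono_neutral_left) (auto simp: in_keys_iff)

lemma keys_add_nat: "Poly_Mapping.keys (a + b) = Poly_Mapping.keys a \<union> Poly_Mapping.keys b"
  for a b :: monomial
  by (auto simp: in_keys_iff lookup_add)

lemma mdeg_add: "mdeg (a + b) = mdeg a + mdeg b"
proof -
  let ?A = "Poly_Mapping.keys a \<union> Poly_Mapping.keys b"
  have "mdeg (a + b) = (\<Sum>i\<in>?A. Poly_Mapping.lookup (a + b) i)"
    by (intro mdeg_eq_sum) (simp_all add: keys_add_nat)
  also have "\<dots> = (\<Sum>i\<in>?A. Poly_Mapping.lookup a i) + (\<Sum>i\<in>?A. Poly_Mapping.lookup b i)"
    by (simp add: lookup_add sum.distrib)
  also have "\<dots> = mdeg a + mdeg b"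
    by (subst (1 2) mdeg_eq_sum[of ?A]) simp_all
  finally show ?thesis .
qed

lemma mdeg_0 [simp]: "mdeg 0 = 0"
  by (simp add: mdeg_def)

lemma mdeg_single [simp]: "mdeg (Poly_Mapping.single i k) = k"
  by (simp add: mdeg_def)

lemma keys_mult_mons:
  assumes "Poly_Mapping.keys p \<subseteq> mons n J" "Poly_Mapping.keys q \<subseteq> mons n K"
    and "\<And>j k. j \<in> J \<Longrightarrow> k \<in> K \<Longrightarrow> j + k \<in> L"
  shows "Poly_Mapping.keys (p * q) \<subseteq> mons n L"
proof
  fix m assume "m \<in> Poly_Mapping.keys (p * q)"
  then obtain a b where m: "m = a + b" and "a \<in> Poly_Mapping.keys p" "b \<in> Poly_Mapping.keys q"
    using keys_mult[of p q] by blast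
  then have "a \<in> mons n J" "b \<in> mons n K"
    using assms(1,2) by blast+
  then show "m \<in> mons n L"
    using assms(3) by (simp add: m mons_def keys_add_nat mdeg_add)
qed

lemma keys_power_mons:
  assumes "Poly_Mapping.keys p \<subseteq> mons n {k}"
  shows "Poly_Mapping.keys (p ^ d) \<subseteq> mons n {d * k}"
proof (induction d)
  case 0
  show ?case by (simp add: mons_def)
next
  case (Suc d)
  show ?case
    unfolding power_Suc by (rule keys_mult_mons[OF assms Suc]) simp
qed

lemma keys_add_mons:
  assumes "Poly_Mapping.keys p \<subseteq> mons n K" "Poly_Mapping.keys q \<subseteq> mons n K"
  shows "Poly_Mapping.keys (p + q) \<subseteq> mons n K"
  by (rule order_trans[OF keys_add]) (simp add: assms)

lemma keys_sum_mons:
  assumes "\<And>i. i \<in> A \<Longrightarrow> Poly_Mapping.keys (f i) \<subseteq> mons n K"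
  shows "Poly_Mapping.keys (\<Sum>i\<in>A. f i) \<subseteq> mons n K"
  using assms by (induction A rule: infinite_finite_induct) (simp_all add: keys_add_mons)

lemma keys_sum_list_mons:
  assumes "\<And>x. x \<in> set xs \<Longrightarrow> Poly_Mapping.keys (f x) \<subseteq> mons n K"
  shows "Poly_Mapping.keys (\<Sum>x\<leftarrow>xs. f x) \<subseteq> mons n K"
  using assms by (induction xs) (simp_all add: keys_add_mons)

lemma keys_const_mpoly: "Poly_Mapping.keys (const_mpoly c) \<subseteq> mons n {0}"
  by (auto simp: const_mpoly_def mons_def)

lemma keys_const_mult_mons:
  assumes "Poly_Mapping.keys p \<subseteq> mons n K"
  shows "Poly_Mapping.keys (const_mpoly c * p) \<subseteq> mons n K"
  by (rule keys_mult_mons[OF keys_const_mpoly assms]) simp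

lemma mons_mono: "J \<subseteq> K \<Longrightarrow> mons n J \<subseteq> mons n K"
  by (auto simp: mons_def)

lemma affine_form_iff: "affine_form n p \<longleftrightarrow> Poly_Mapping.keys p \<subseteq> mons n {..1}"
  by (simp add: affine_form_def keys_subset_mons_iff)

text \<open>Stars and bars: the exponent vector, read as a list of length \<open>n\<close> with sum
  \<open>k\<close>, determines the monomial.\<close>

lemma finite_card_mons:
  assumes "n \<ge> 1"
  shows "finite (mons n {k}) \<and> card (mons n {k}) \<le> (n + k - 1) choose k"
proof -
  let ?f = "\<lambda>m::monomial. map (Poly_Mapping.lookup m) [1..<Suc n]"
  let ?B = "{l::nat list. size l = n \<and> sum_list l = k}"
  have inj: "inj_on ?f (mons n {k})"
  proof (rule inj_onI, rule poly_mapping_eqI)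
    fix a b i
    assume ab: "a \<in> mons n {k}" "b \<in> mons n {k}" "?f a = ?f b"
    show "Poly_Mapping.lookup a i = Poly_Mapping.lookup b i"
    proof (cases "i \<in> {1..n}")
      case True
      then show ?thesis using ab(3) by (auto simp: map_eq_conv)
    next
      case False
      then have "i \<notin> Poly_Mapping.keys a" "i \<notin> Poly_Mapping.keys b"
        using ab by (auto simp: mons_def)
      then show ?thesis by (simp add: in_keys_iff)
    qed
  qed
  have sub: "?f ` mons n {k} \<subseteq> ?B"
  proof (rule image_subsetI)
    fix m assume "m \<in> mons n {k}"
    then have "k = (\<Sum>i\<in>{1..n}. Poly_Mapping.lookup m i)"
      by (subst mdeg_eq_sum[symmetric]) (auto simp: mons_def)
    also have "\<dots> = sum_list (?f m)"
      by (subst sum_list_distinct_conv_sum_set) (auto intro!: sum.cong)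
    finally show "?f m \<in> ?B" by simp
  qed
  have card: "card ?B = (n + k - 1) choose k"
    by (simp add: card_length_sum_list add.commute)
  \<comment> \<open>An infinite set has \<open>card\<close> 0, whereas this binomial coefficient is
    positive because \<open>n \<ge> 1\<close>.\<close>
  then have fin: "finite ?B"
    using assms by (intro card_ge_0_finite) (simp add: zero_less_binomial)
  show ?thesis
    using finite_imageD[OF finite_subset[OF sub fin] inj] card_mono[OF fin sub] card_image[OF inj] card
    by simp
qed

section \<open>Sums of powers of linear forms\<close>

text \<open>One entry per subset of positions, carrying the sum over the subset and the sign
  \<open>(-1)^r\<close>, where \<open>r\<close> counts the omitted positions. A list keeps
  coinciding sums apart.\<close>

primrec signed_subsums :: "'a::comm_monoid_add list \<Rightarrow> (int \<times> 'a) list" where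
  "signed_subsums [] = [(1, 0)]"
| "signed_subsums (y # ys) =
     map (\<lambda>(s, t). (s, t + y)) (signed_subsums ys) @ map (\<lambda>(s, t). (- s, t)) (signed_subsums ys)"

lemma length_signed_subsums: "length (signed_subsums ys) = 2 ^ length ys"
  by (induction ys) simp_all

lemma signed_subsums_zero: "\<exists>s. (s, 0) \<in> set (signed_subsums ys)"
  by (induction ys) (simp, force)

lemma keys_signed_subsums:
  assumes "\<And>y. y \<in> set ys \<Longrightarrow> Poly_Mapping.keys y \<subseteq> mons n K"
    and "(s, t) \<in> set (signed_subsums ys)"
  shows "Poly_Mapping.keys t \<subseteq> mons n K"
  using assms
proof (induction ys arbitrary: s t)
  case (Cons y ys)
  have IH: "Poly_Mapping.keys t' \<subseteq> mons n K" if "(s', t') \<in> set (signed_subsums ys)" for s' t'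
    using Cons.IH Cons.prems(1) that by simp
  from Cons.prems(2) consider s' t' where "(s', t') \<in> set (signed_subsums ys)" "t = t' + y"
    | s' where "(s', t) \<in> set (signed_subsums ys)"
    by auto
  then show ?case
    using IH Cons.prems(1)[of y] by cases (simp_all add: keys_add_mons)
qed simp

lemma sum_list_sum_swap: "(\<Sum>x\<leftarrow>xs. \<Sum>i\<in>A. f x i) = (\<Sum>i\<in>A. \<Sum>x\<leftarrow>xs. f x i)"
  by (induction xs) (simp_all add: sum.distrib)

text \<open>The left-hand side is the iterated finite difference of \<open>z \<mapsto> z\<^sup>j\<close> at \<open>x\<close> along \<open>ys\<close>.\<close>

lemma sum_signed_subsums_power:
  fixes x :: "'a::comm_ring_1"
  assumes "j \<le> length ys"
  shows "(\<Sum>(s, t)\<leftarrow>signed_subsums ys. of_int s * (x + t) ^ j)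
    = (if j = length ys then of_nat (fact j) * prod_list ys else 0)"
  using assms
proof (induction ys arbitrary: j)
  case (Cons y ys)
  let ?D = "\<lambda>i. \<Sum>(s, t)\<leftarrow>signed_subsums ys. of_int s * (x + t) ^ i"
  \<comment> \<open>Differencing along \<open>y\<close> lowers the degree in \<open>z\<close>, so
    the induction hypothesis applies to each power \<open>z^i\<close> with
    \<open>i < j\<close>.\<close>
  have expand: "(z + y) ^ j - z ^ j = (\<Sum>i<j. of_nat (j choose i) * y ^ (j - i) * z ^ i)" for z :: 'a
    by (simp add: binomial_ring lessThan_Suc_atMost[symmetric] mult_ac)
  have "(\<Sum>(s, t)\<leftarrow>signed_subsums (y # ys). of_int s * (x + t) ^ j)
      = (\<Sum>(s, t)\<leftarrow>signed_subsums ys. of_int s * ((x + t + y) ^ j - (x + t) ^ j))"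
    by (simp add: case_prod_unfold o_def add.assoc right_diff_distrib sum_list_subtractf
        uminus_sum_list_map)
  also have "\<dots> = (\<Sum>(s, t)\<leftarrow>signed_subsums ys.
      \<Sum>i<j. of_nat (j choose i) * y ^ (j - i) * (of_int s * (x + t) ^ i))"
    unfolding expand by (simp add: sum_distrib_left mult_ac)
  also have "\<dots> = (\<Sum>i<j. of_nat (j choose i) * y ^ (j - i) * ?D i)"
    by (simp add: case_prod_unfold sum_list_sum_swap sum_list_const_mult)
  \<comment> \<open>Here \<open>i < j \<le> length ys + 1\<close>, so a term survives only for
    \<open>j = length ys + 1\<close> and \<open>i = j - 1\<close>; then
    \<open>j choose i = j\<close> completes the factorial.\<close>
  also have "\<dots> = (\<Sum>i<j. if i = length ys
      then of_nat (j choose i) * y ^ (j - i) * (of_nat (fact i) * prod_list ys) else 0)"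
    using Cons.prems by (intro sum.cong) (auto simp: Cons.IH)
  also have "\<dots> = (if j = length (y # ys) then of_nat (fact j) * prod_list (y # ys) else 0)"
    using Cons.prems by (auto simp: sum.delta algebra_simps)
  finally show ?case .
qed simp

text \<open>The difference identity at \<open>x = 0\<close>, \<open>j = d\<close> expresses
  \<open>d!\<close> times the product through d-th powers of subset sums. Each scalar
  \<open>s / d!\<close> has a complex d-th root, which is absorbed into its linear form.\<close>

lemma prod_list_eq_sum_powers:
  fixes ys :: "complex mpoly list"
  assumes "length ys = d" "d \<ge> 1"
    and "\<And>y. y \<in> set ys \<Longrightarrow> Poly_Mapping.keys y \<subseteq> mons n {1}"
  shows "\<exists>Ls. length Ls \<le> 2 ^ d - 1 \<and> (\<forall>L\<in>set Ls. Poly_Mapping.keys L \<subseteq> mons n {1})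
    \<and> prod_list ys = (\<Sum>L\<leftarrow>Ls. L ^ d)"
proof -
  interpret const: comm_ring_map "const_mpoly :: complex \<Rightarrow> _"
    by (rule comm_ring_map_const_mpoly)
  have "\<exists>c::complex. c ^ d = of_int s / fact d" for s
    using assms(2) by (intro nth_root_exists) simp
  then obtain c :: "int \<Rightarrow> complex" where c: "c s ^ d = of_int s / fact d" for s
    by metis
  let ?S = "signed_subsums ys"
  \<comment> \<open>Dropping zero sums loses nothing, as \<open>0^d = 0\<close> for
    \<open>d \<ge> 1\<close>, and removes at least the empty subset.\<close>
  let ?Ls = "map (\<lambda>(s, t). const_mpoly (c s) * t) (filter (\<lambda>(s, t). t \<noteq> 0) ?S)"
  have "length (filter (\<lambda>(s, t). t \<noteq> 0) ?S) < length ?S"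
    using signed_subsums_zero[of ys] by (auto intro!: length_filter_less)
  then have "length ?Ls \<le> 2 ^ d - 1"
    using assms(1) by (simp add: length_signed_subsums)
  moreover have "\<forall>L\<in>set ?Ls. Poly_Mapping.keys L \<subseteq> mons n {1}"
  proof
    fix L assume "L \<in> set ?Ls"
    then obtain s t where "L = const_mpoly (c s) * t" "(s, t) \<in> set ?S" by auto
    then show "Poly_Mapping.keys L \<subseteq> mons n {1}"
      using keys_const_mult_mons[OF keys_signed_subsums[OF assms(3)]] by simp
  qed
  moreover have "prod_list ys = (\<Sum>L\<leftarrow>?Ls. L ^ d)"
  proof -
    have "(\<Sum>L\<leftarrow>?Ls. L ^ d) = (\<Sum>(s, t)\<leftarrow>filter (\<lambda>(s, t). t \<noteq> 0) ?S. (const_mpoly (c s) * t) ^ d)"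
      by (simp add: o_def case_prod_unfold)
    also have "\<dots> = (\<Sum>(s, t)\<leftarrow>?S. (const_mpoly (c s) * t) ^ d)"
      using assms(2) by (intro sum_list_map_filter) (auto simp: zero_power)
    also have "\<dots> = (\<Sum>(s, t)\<leftarrow>?S. const_mpoly (1 / fact d) * (of_int s * (0 + t) ^ d))"
    proof -
      have "const_mpoly (c s) ^ d = const_mpoly (1 / fact d) * of_int s" for s
      proof -
        have "const_mpoly (c s) ^ d = const_mpoly (1 / fact d * of_int s)"
          by (simp add: c flip: const.power)
        also have "\<dots> = const_mpoly (1 / fact d) * const_mpoly (of_int s)"
          by (rule const.mult)
        finally show ?thesis by (simp add: const_mpoly_def)
      qed
      then show ?thesis by (simp add: power_mult_distrib mult.assoc)
    qed
    also have "\<dots> = const_mpoly (1 / fact d) * (of_nat (fact d) * prod_list ys)"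
      using sum_signed_subsums_power[of d ys 0] assms(1)
      by (simp add: case_prod_unfold sum_list_const_mult)
    also have "\<dots> = prod_list ys"
    proof -
      have "of_nat (fact d) = (const_mpoly (of_nat (fact d)) :: complex mpoly)"
        by (simp only: const_mpoly_def single_of_nat)
      then have "const_mpoly (1 / fact d) * of_nat (fact d) = (1 :: complex mpoly)"
        by (simp only: const.mult[symmetric]) (simp add: const.one)
      then show ?thesis by (simp flip: mult.assoc)
    qed
    finally show ?thesis ..
  qed
  ultimately show ?thesis by blast
qed

lemma mons_Suc_peel:
  assumes "m \<in> mons n {Suc k}"
  shows "\<exists>m' i. m' \<in> mons n {k} \<and> i \<in> {1..n} \<and> m = m' + Poly_Mapping.single i 1"
proof -
  from assms have "Poly_Mapping.keys m \<noteq> {}"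
    by (auto simp: mons_def mdeg_def)
  then obtain i where i: "i \<in> Poly_Mapping.keys m" by blast
  \<comment> \<open>Subtraction of exponents is truncated; adding the variable back restores
    \<open>m\<close> because \<open>i\<close> occurs in \<open>m\<close>.\<close>
  let ?m' = "m - Poly_Mapping.single i 1"
  have m: "m = ?m' + Poly_Mapping.single i 1"
    using i by (intro poly_mapping_eqI)
      (auto simp: lookup_add lookup_minus lookup_single when_def in_keys_iff)
  have "mdeg m = mdeg ?m' + 1"
    by (subst m) (simp only: mdeg_add mdeg_single)
  moreover have "Poly_Mapping.keys ?m' \<subseteq> Poly_Mapping.keys m"
    by (auto simp: in_keys_iff lookup_minus)
  ultimately have "?m' \<in> mons n {k}" "i \<in> {1..n}"
    using assms i by (auto simp: mons_def)
  with m show ?thesis by blast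
qed

lemma keys_variable: "i \<in> {1..n} \<Longrightarrow> Poly_Mapping.keys (Poly_Mapping.single (Poly_Mapping.single i 1) c) \<subseteq> mons n {1}"
  by (auto simp: mons_def)

lemma monomial_eq_prod_list:
  assumes "m \<in> mons n {k}"
  shows "\<exists>ys. length ys = k \<and> (\<forall>y\<in>set ys. Poly_Mapping.keys y \<subseteq> mons n {1})
    \<and> Poly_Mapping.single m (1::'a::comm_semiring_1) = prod_list ys"
  using assms
proof (induction k arbitrary: m)
  case 0
  then have "m = 0"
    by (intro poly_mapping_eqI) (auto simp: mons_def mdeg_def in_keys_iff)
  then show ?case by simp
next
  case (Suc k)
  from mons_Suc_peel[OF Suc.prems] obtain m' i where m': "m' \<in> mons n {k}" "i \<in> {1..n}"
    "m = m' + Poly_Mapping.single i 1" by blast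
  from Suc.IH[OF m'(1)] obtain ys where ys: "length ys = k"
    "\<forall>y\<in>set ys. Poly_Mapping.keys y \<subseteq> mons n {1}" "Poly_Mapping.single m' (1::'a) = prod_list ys"
    by blast
  have "Poly_Mapping.single m (1::'a) = prod_list (Poly_Mapping.single (Poly_Mapping.single i 1) 1 # ys)"
    by (simp add: m'(3) mult_single add.commute flip: ys(3))
  then show ?case
    using ys(1,2) keys_variable[OF m'(2), of "1::'a"]
    by (intro exI[of _ "Poly_Mapping.single (Poly_Mapping.single i 1) 1 # ys"]) auto
qed

lemma poly_mapping_eq_sum_single:
  "p = (\<Sum>m\<in>Poly_Mapping.keys p. Poly_Mapping.single m (Poly_Mapping.lookup p m))"
  by (rule poly_mapping_eqI) (auto simp: lookup_sum lookup_single when_def in_keys_iff)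

text \<open>Grouping the monomials of degree \<open>k + 1\<close> by a divisor of degree \<open>k\<close> writes \<open>P\<close> as a sum of
  products of linear forms indexed by the monomials of degree \<open>k\<close> rather than \<open>k + 1\<close>.\<close>

lemma sum_monomial_times_linear:
  fixes P :: "'a::comm_semiring_1 mpoly"
  assumes "Poly_Mapping.keys P \<subseteq> mons n {Suc k}"
  shows "\<exists>I l. I \<subseteq> mons n {k} \<and> (\<forall>m. Poly_Mapping.keys (l m) \<subseteq> mons n {1})
    \<and> P = (\<Sum>m\<in>I. Poly_Mapping.single m 1 * l m)"
proof -
  have "\<forall>m\<in>Poly_Mapping.keys P. \<exists>m' i. m' \<in> mons n {k} \<and> i \<in> {1..n} \<and> m = m' + Poly_Mapping.single i 1"
    using assms mons_Suc_peel by blast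
  then obtain par v where pv: "\<And>m. m \<in> Poly_Mapping.keys P \<Longrightarrow>
      par m \<in> mons n {k} \<and> v m \<in> {1..n} \<and> m = par m + Poly_Mapping.single (v m) 1"
    by metis
  \<comment> \<open>The cofactor of \<open>m'\<close> collects the leftover variables
    \<open>v m\<close> of all monomials \<open>m\<close> of \<open>P\<close> assigned to the divisor
    \<open>m'\<close>.\<close>
  define l :: "monomial \<Rightarrow> 'a mpoly" where "l m' = (\<Sum>m\<in>{m \<in> Poly_Mapping.keys P. par m = m'}.
    Poly_Mapping.single (Poly_Mapping.single (v m) 1) (Poly_Mapping.lookup P m))" for m'
  have "P = (\<Sum>m\<in>Poly_Mapping.keys P. Poly_Mapping.single m (Poly_Mapping.lookup P m))"
    by (rule poly_mapping_eq_sum_single)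
  also have "\<dots> = (\<Sum>m\<in>Poly_Mapping.keys P. Poly_Mapping.single (par m) 1
      * Poly_Mapping.single (Poly_Mapping.single (v m) 1) (Poly_Mapping.lookup P m))"
    using pv by (intro sum.cong) (simp_all add: mult_single)
  also have "\<dots> = (\<Sum>m'\<in>par ` Poly_Mapping.keys P. Poly_Mapping.single m' 1 * l m')"
    by (subst sum.image_gen[of _ _ par]) (auto simp: l_def sum_distrib_left intro!: sum.cong)
  finally have "P = (\<Sum>m'\<in>par ` Poly_Mapping.keys P. Poly_Mapping.single m' 1 * l m')" .
  moreover have "Poly_Mapping.keys (l m) \<subseteq> mons n {1}" for m
    unfolding l_def using pv by (intro keys_sum_mons keys_variable) blast
  ultimately show ?thesis
    using pv by (intro exI[of _ "par ` Poly_Mapping.keys P"] exI[of _ l]) auto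
qed

text \<open>Each summand is a product of \<open>d\<close> linear forms, \<open>d - 1\<close>
  variables and one cofactor, to which polarization applies. Polarizing every monomial of degree
  \<open>d\<close> separately would involve up to \<open>(n + d - 1) choose d\<close> products, too
  many when \<open>n > d\<close>.\<close>

lemma homogeneous_eq_sum_powers:
  fixes P :: "complex mpoly"
  assumes "n \<ge> 1" "d \<ge> 1" and P: "Poly_Mapping.keys P \<subseteq> mons n {d}"
  shows "\<exists>Ls. length Ls \<le> (2 ^ d - 1) * ((n + d - 1) choose (d - 1))
    \<and> (\<forall>L\<in>set Ls. Poly_Mapping.keys L \<subseteq> mons n {1}) \<and> P = (\<Sum>L\<leftarrow>Ls. L ^ d)"
proof -
  obtain k where k: "d = Suc k" using assms(2) by (cases d) auto
  from sum_monomial_times_linear[OF P[unfolded k]] obtain I l where I: "I \<subseteq> mons n {k}"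
    and l: "\<And>m. Poly_Mapping.keys (l m) \<subseteq> mons n {1}"
    and P_eq: "P = (\<Sum>m\<in>I. Poly_Mapping.single m 1 * l m)" by blast
  have "finite I" and "card I \<le> (n + k - 1) choose k"
    using I finite_card_mons[OF assms(1), of k] finite_subset card_mono order_trans by metis+
  moreover have "(n + k - 1) choose k \<le> (n + d - 1) choose (d - 1)"
    by (simp add: k binomial_right_mono)
  ultimately have card: "card I \<le> (n + d - 1) choose (d - 1)" by linarith
  \<comment> \<open>Stated for the partial sums over \<open>I\<close>, so that induction on the
    finite set can concatenate the lists of powers.\<close>
  have "\<exists>Ls. length Ls \<le> card I * (2 ^ d - 1)
    \<and> (\<forall>L\<in>set Ls. Poly_Mapping.keys L \<subseteq> mons n {1})
    \<and> (\<Sum>m\<in>I. Poly_Mapping.single m 1 * l m) = (\<Sum>L\<leftarrow>Ls. L ^ d)"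
    using \<open>finite I\<close> I
  proof (induction I)
    case empty
    show ?case by simp
  next
    case (insert m I)
    from insert obtain Ls where Ls: "length Ls \<le> card I * (2 ^ d - 1)"
      "\<forall>L\<in>set Ls. Poly_Mapping.keys L \<subseteq> mons n {1}"
      "(\<Sum>m\<in>I. Poly_Mapping.single m 1 * l m) = (\<Sum>L\<leftarrow>Ls. L ^ d)" by auto
    from monomial_eq_prod_list[of m n k] insert.prems obtain ys where ys: "length ys = k"
      "\<forall>y\<in>set ys. Poly_Mapping.keys y \<subseteq> mons n {1}"
      "Poly_Mapping.single m (1::complex) = prod_list ys" by blast
    have "\<exists>Ls. length Ls \<le> 2 ^ d - 1 \<and> (\<forall>L\<in>set Ls. Poly_Mapping.keys L \<subseteq> mons n {1})
      \<and> prod_list (l m # ys) = (\<Sum>L\<leftarrow>Ls. L ^ d)"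
      using ys l assms(2) k by (intro prod_list_eq_sum_powers) auto
    then obtain Ks where "length Ks \<le> 2 ^ d - 1"
      "\<forall>L\<in>set Ks. Poly_Mapping.keys L \<subseteq> mons n {1}"
      "prod_list (l m # ys) = (\<Sum>L\<leftarrow>Ks. L ^ d)" by blast
    with Ls insert.hyps ys(3) show ?case
      by (intro exI[of _ "Ks @ Ls"]) (auto simp: mult.commute)
  qed
  then obtain Ls where Ls: "length Ls \<le> card I * (2 ^ d - 1)"
    "\<forall>L\<in>set Ls. Poly_Mapping.keys L \<subseteq> mons n {1}" "P = (\<Sum>L\<leftarrow>Ls. L ^ d)"
    using P_eq by blast
  have "card I * (2 ^ d - 1) \<le> (2 ^ d - 1) * ((n + d - 1) choose (d - 1))"
    using card by (simp add: mult.commute)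
  with Ls show ?thesis using order_trans[OF Ls(1)] by (intro exI[of _ Ls] conjI) blast+
qed

section \<open>The circuit\<close>

text \<open>Induction on \<open>Ls\<close>: each new factor \<open>1 + u^d L^d\<close> splits into
  \<open>d\<close> affine forms. Allowing any commutative ring of coefficients permits working over
  polynomials in \<open>eps\<close>, so that \<open>G\<close> has no denominators.\<close>

lemma prod_one_plus_powers:
  fixes Ls :: "complex mpoly list" and h :: "complex \<Rightarrow> 'a::comm_ring_1" and t :: 'a
  assumes "comm_ring_map h" "d \<ge> 1"
    and "\<And>L. L \<in> set Ls \<Longrightarrow> Poly_Mapping.keys L \<subseteq> mons n {1}"
  defines "\<iota> \<equiv> Poly_Mapping.map h" and "u \<equiv> const_mpoly t"
  shows "\<exists>A G. length A = d * length Ls \<and> (\<forall>a\<in>set A. affine_form n a)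
    \<and> Poly_Mapping.keys G \<subseteq> mons n {d<..}
    \<and> prod_list A = 1 + u ^ d * (\<Sum>L\<leftarrow>Ls. \<iota> L ^ d) + u ^ d * u ^ d * G"
  using assms(3)
proof (induction Ls)
  case Nil
  show ?case by (intro exI[of _ "[]"] exI[of _ 0]) simp
next
  case (Cons L Ls)
  interpret h: comm_ring_map h by fact
  interpret const: comm_ring_map "const_mpoly :: 'a \<Rightarrow> _"
    by (rule comm_ring_map_const_mpoly)
  from Cons obtain A G where A: "length A = d * length Ls" "\<forall>a\<in>set A. affine_form n a"
    and G: "Poly_Mapping.keys G \<subseteq> mons n {d<..}"
    and eq: "prod_list A = 1 + u ^ d * (\<Sum>L\<leftarrow>Ls. \<iota> L ^ d) + u ^ d * u ^ d * G" by auto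
  have keys: "Poly_Mapping.keys (\<iota> K) \<subseteq> mons n {1}" if "K \<in> set (L # Ls)" for K
    unfolding \<iota>_def by (rule order_trans[OF h.keys_map_subset Cons.prems[OF that]])
  then have power: "Poly_Mapping.keys (\<iota> K ^ d) \<subseteq> mons n {d}" if "K \<in> set (L # Ls)" for K
    using keys_power_mons[of "\<iota> K" n 1 d] that by simp
  obtain cs :: "complex list" where cs: "length cs = d"
    "\<And>h T. comm_ring_map h \<Longrightarrow> 1 + (T :: 'a mpoly) ^ d = (\<Prod>c\<leftarrow>cs. 1 + h c * T)"
    using one_plus_power_factorization[OF assms(2)] by blast
  have "comm_ring_map (\<lambda>c. const_mpoly (h c))"
    by standard (simp_all add: h.add h.mult h.one const.add const.mult const.one)
  from cs(2)[OF this, of "u * \<iota> L"]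
  have fact: "1 + u ^ d * \<iota> L ^ d = (\<Prod>c\<leftarrow>cs. 1 + const_mpoly (h c) * (u * \<iota> L))"
    by (simp add: power_mult_distrib)
  let ?B = "map (\<lambda>c. 1 + const_mpoly (h c) * (u * \<iota> L)) cs"
  \<comment> \<open>With \<open>S\<close> the old sum of powers, this is the cofactor of
    \<open>u^(2d)\<close> in \<open>(1 + u^d L^d) (1 + u^d S + u^(2d) G)\<close>. The new term
    \<open>L^d S\<close> lives in degree \<open>2d\<close>, which exceeds \<open>d\<close> as
    \<open>d \<ge> 1\<close>.\<close>
  let ?G = "G + \<iota> L ^ d * (\<Sum>L\<leftarrow>Ls. \<iota> L ^ d) + u ^ d * (\<iota> L ^ d * G)"
  have "affine_form n (1 + const_mpoly (h c) * (u * \<iota> L))" for c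
    unfolding affine_form_iff u_def
    using keys[of L] mons_mono[of "{1}" "{..1}" n]
    by (intro keys_add_mons keys_const_mult_mons) (auto simp: mons_def)
  then have "\<forall>a\<in>set (?B @ A). affine_form n a"
    using A(2) by auto
  moreover have "Poly_Mapping.keys ?G \<subseteq> mons n {d<..}"
  proof (intro keys_add_mons G)
    show "Poly_Mapping.keys (\<iota> L ^ d * (\<Sum>L\<leftarrow>Ls. \<iota> L ^ d)) \<subseteq> mons n {d<..}"
      using assms(2) by (intro keys_mult_mons[OF power keys_sum_list_mons[OF power]]) auto
    have "Poly_Mapping.keys (\<iota> L ^ d * G) \<subseteq> mons n {d<..}"
      by (rule keys_mult_mons[OF power G]) auto
    then show "Poly_Mapping.keys (u ^ d * (\<iota> L ^ d * G)) \<subseteq> mons n {d<..}"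
      unfolding u_def const.power[symmetric] by (rule keys_const_mult_mons)
  qed
  moreover have "prod_list (?B @ A) = 1 + u ^ d * (\<Sum>L\<leftarrow>L # Ls. \<iota> L ^ d) + u ^ d * u ^ d * ?G"
    by (simp add: eq fact[symmetric]) (simp add: algebra_simps)
  moreover have "length (?B @ A) = d * length (L # Ls)"
    by (simp add: cs(1) A(1))
  ultimately show ?case by blast
qed

theorem theorem1p2:
  fixes n d :: nat and P :: "complex mpoly"
  assumes "n \<ge> 1" and "d \<ge> 1"
    and "in_vars n P" and "homogeneous d P"
  shows "\<exists>(C :: ratfun circuit) (Q :: complex poly mpoly).
           depth3_circuit n C
         \<and> top_fanin C \<le> d + 1
         \<and> formal_degree C \<le> d * 2 ^ d * ((n + d - 1) choose (d - 1))
         \<and> in_vars n Q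
         \<and> (\<forall>m\<in>Poly_Mapping.keys Q. mdeg m > d)
         \<and> computed_poly C
             = Poly_Mapping.map emb_const P + const_mpoly eps * Poly_Mapping.map emb_poly Q"
proof -
  let ?N = "(n + d - 1) choose (d - 1)"
  interpret const: comm_ring_map "const_mpoly :: ratfun \<Rightarrow> _"
    by (rule comm_ring_map_const_mpoly)
  interpret emb: comm_ring_map emb_poly
    by (rule comm_ring_map_emb_poly)
  interpret E: comm_ring_map "Poly_Mapping.map emb_poly :: complex poly mpoly \<Rightarrow> _"
    by (rule emb.map_poly_mapping)
  interpret c: comm_ring_map "\<lambda>c::complex. [:c:]"
    by (rule comm_ring_map_const_poly)
  interpret \<iota>: comm_ring_map "Poly_Mapping.map (\<lambda>c::complex. [:c:]) :: complex mpoly \<Rightarrow> _"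
    by (rule c.map_poly_mapping)
  let ?E = "Poly_Mapping.map emb_poly :: complex poly mpoly \<Rightarrow> _"
  let ?\<iota> = "Poly_Mapping.map (\<lambda>c::complex. [:c:])"
  let ?u = "const_mpoly [:0, 1:] :: complex poly mpoly"
  let ?e = "const_mpoly eps"
  let ?i = "inverse (eps ^ d)"
  have "Poly_Mapping.keys P \<subseteq> mons n {d}"
    using assms(3,4) by (simp add: keys_subset_mons_iff homogeneous_def)
  from homogeneous_eq_sum_powers[OF assms(1,2) this] obtain Ls
    where len: "length Ls \<le> (2 ^ d - 1) * ?N"
      and lin: "\<forall>L\<in>set Ls. Poly_Mapping.keys L \<subseteq> mons n {1}"
      and P: "P = (\<Sum>L\<leftarrow>Ls. L ^ d)" by blast
  \<comment> \<open>The product is built over \<open>complex poly\<close> and only then mapped by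
    \<open>?E\<close> into the rational functions.\<close>
  from prod_one_plus_powers[OF comm_ring_map_const_poly assms(2), of Ls n "[:0, 1:]"] lin
  obtain A G where A: "length A = d * length Ls" "\<forall>a\<in>set A. affine_form n a"
    and G: "Poly_Mapping.keys G \<subseteq> mons n {d<..}"
    and "prod_list A = 1 + ?u ^ d * (\<Sum>L\<leftarrow>Ls. ?\<iota> L ^ d) + ?u ^ d * ?u ^ d * G" by blast
  then have prod: "prod_list A = 1 + ?u ^ d * ?\<iota> P + ?u ^ d * ?u ^ d * G"
    by (simp add: P \<iota>.sum_list \<iota>.power o_def)
  have Eu: "?E ?u = ?e"
    by (simp add: const_mpoly_def emb.map_single eps_def)
  have E\<iota>: "?E (?\<iota> P) = Poly_Mapping.map emb_const P"
    by (rule poly_mapping_eqI)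
      (simp add: emb.lookup_map c.lookup_map Poly_Mapping.map.rep_eq emb_const_def when_def emb.zero)
  have eprod: "prod_list (map ?E A)
      = 1 + ?e ^ d * Poly_Mapping.map emb_const P + ?e ^ d * ?e ^ d * ?E G"
    unfolding E.prod_list[symmetric] prod by (simp add: E.add E.mult E.one E.power Eu E\<iota>)
  have "eps \<noteq> 0"
    by (simp add: eps_def emb_poly_def Zero_fract_def eq_fract)
  then have inv: "const_mpoly ?i * ?e ^ d = 1"
    by (simp add: const.one flip: const.power const.mult)
  \<comment> \<open>The first gate takes the scalar eps^(-d) as an extra input; the second is a
    constant cancelling the leading 1 of the product after scaling.\<close>
  define C where "C = [const_mpoly ?i # map ?E A, [const_mpoly (- ?i)]]"
  \<comment> \<open>After division the error is \<open>eps^d G\<close>; one factor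
    \<open>eps\<close> is set apart, which \<open>d \<ge> 1\<close> allows.\<close>
  define Q where "Q = ?u ^ (d - 1) * G"
  have "affine_form n (?E a)" if "a \<in> set A" for a
    using that A(2) emb.keys_map_subset[of a] unfolding affine_form_iff by blast
  moreover have "affine_form n (const_mpoly x)" for x :: ratfun
    using keys_const_mpoly[of x n] mons_mono[of "{0}" "{..1}" n] by (auto simp: affine_form_iff)
  ultimately have "depth3_circuit n C"
    by (auto simp: depth3_circuit_def C_def)
  moreover have "top_fanin C \<le> d + 1"
    using assms(2) by (simp add: top_fanin_def C_def)
  moreover have "formal_degree C \<le> d * 2 ^ d * ?N"
  proof -
    have "?N \<ge> 1"
      using assms(1) by (simp add: Suc_le_eq zero_less_binomial)
    \<comment> \<open>The scalar input costs 1, paid for by the \<open>d * ?N\<close> left over from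
      \<open>2^d - 1\<close> in place of \<open>2^d\<close>.\<close>
    have "d * length Ls + 1 \<le> d * ((2 ^ d - 1) * ?N) + d * ?N"
      using len assms(2) \<open>?N \<ge> 1\<close> by (intro add_mono mult_le_mono) (auto simp: Suc_le_eq)
    also have "\<dots> = d * (2 ^ d - 1 + 1) * ?N"
      by (simp add: algebra_simps)
    also have "\<dots> = d * 2 ^ d * ?N" by simp
    finally show ?thesis
      by (simp add: formal_degree_def C_def A(1))
  qed
  moreover have "Poly_Mapping.keys Q \<subseteq> mons n {d<..}"
    unfolding Q_def comm_ring_map.power[OF comm_ring_map_const_mpoly, symmetric]
    by (rule keys_const_mult_mons[OF G])
  then have "in_vars n Q" "\<forall>m\<in>Poly_Mapping.keys Q. mdeg m > d"
    by (simp_all add: keys_subset_mons_iff)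
  moreover have "computed_poly C = Poly_Mapping.map emb_const P + ?e * ?E Q"
  proof -
    have "computed_poly C = const_mpoly ?i * prod_list (map ?E A) - const_mpoly ?i"
      by (simp add: computed_poly_def C_def const.uminus)
    also have "\<dots> = const_mpoly ?i * ?e ^ d * (Poly_Mapping.map emb_const P + ?e ^ d * ?E G)"
      unfolding eprod by (simp add: algebra_simps)
    also have "\<dots> = Poly_Mapping.map emb_const P + ?e ^ d * ?E G"
      by (simp add: inv)
    also have "?e ^ d * ?E G = ?e * ?E Q"
      using assms(2) by (simp add: Q_def E.mult E.power Eu mult.assoc flip: power_Suc)
    finally show ?thesis .
  qed
  ultimately show ?thesis by blast
qed

end
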